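(* For any $r>0$, $g\in L_p(S;X)$ and $\varphi\in L_q(S;X^* )$: (a) $\pi_{B_p(r)}(\varphi)=J_q^*(\varphi)$, if $\|\varphi\|_{L_q(S;X^* )}\le r$; (b) $\pi_{B_p(r)}(\varphi)=\dfrac{r}{\|\varphi\|_{L_q(S;X^* )}}J_q^*(\varphi)$, if $\|\varphi\|_{L_q(S;X^* )}>r$; (c) $\Pi_{B_p(r)}(g)=g$, for $g\in B_p(r)$; (d) $\Pi_{B_p(r)}(g)=\dfrac{r}{\|g\|_{L_p(S;X)}}g$, for $g\in L_p(S;X)\setminus B_p(r)$; (e) $P_{B_p(r)}(g)=g$, for $g\in B_p(r)$; (f) $P_{B_p(r)}(g)=\dfrac{r}{\|g\|_{L_p(S;X)}}g$, for $g\in L_p(S;X)\setminus B_p(r)$.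
   Context: Setting: $(S,\mathcal{A},\mu)$ is a positive complete measure space, $(X,\|\cdot\|_X)$ is a real uniformly convex and uniformly smooth Banach space with dual $X^*$, and $1<p,q<\infty$ with $\frac1p+\frac1q=1$. $L_p(S;X)$ is the Bochner space of ($\mu$-equivalence classes of) strongly $\mu$-measurable $f:S\to X$ with $\|f\|_{L_p(S;X)}=\left(\int_S\|f(s)\|_X^p\,d\mu(s)\right)^{1/p}<\infty$; it is uniformly convex and uniformly smooth with dual $L_q(S;X^* )$ under the pairing $\langle\varphi,f\rangle=\int_S\langle\varphi(s),f(s)\rangle\,d\mu(s)$. The origin of $L_p(S;X)$ is $\theta$; $B_p(r)$ is the closed ball in $L_p(S;X)$ with center $\theta$ and radius $r$. Normalized duality mappings: for a uniformly convex and uniformly smooth Banach space $Y$, $J_Y:Y\to Y^*$ is the single-valued mapping determined by $\langle J_Yy,y\rangle=\|J_Yy\|_{Y^*}\|y\|_Y=\|y\|_Y^2=\|J_Yy\|_{Y^*}^2$. Write $J_p=J_{L_p(S;X)}:L_p(S;X)\to L_q(S;X^* )$ and $J_q^*=J_{L_q(S;X^* )}:L_q(S;X^* )\to L_p(S;X)$ (using reflexivity). Projections: let $C$ be a nonempty closed convex subset of $L_p(S;X)$. The metric projection $P_C:L_p(S;X)\to C$ is given by $\|g-P_Cg\|_{L_p(S;X)}\le\|g-z\|_{L_p(S;X)}$ for all $z\in C$. With $V(\varphi,f)=\|\varphi\|_{L_q(S;X^* )}^2-2\langle\varphi,f\rangle+\|f\|_{L_p(S;X)}^2$, the generalized projection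 $\pi_C:L_q(S;X^* )\to C$ is the single-valued mapping given by $V(\varphi,\pi_C\varphi)=\inf_{f\in C}V(\varphi,f)$. The generalized metric projection $\Pi_C:L_p(S;X)\to C$ is $\Pi_Cg=\pi_C(J_pg)$. *)

theory Defs
  imports "HOL-Analysis.Analysis"
begin

section \<open>Uniform convexity and uniform smoothness\<close>

definition uniformly_convex :: "'x::real_normed_vector itself \<Rightarrow> bool" where
  "uniformly_convex _ \<longleftrightarrow>
     (\<forall>\<epsilon>. 0 < \<epsilon> \<and> \<epsilon> \<le> 2 \<longrightarrow>
       (\<exists>\<delta>>0. \<forall>x y :: 'x. norm x = 1 \<and> norm y = 1 \<and> norm (x - y) \<ge> \<epsilon>
          \<longrightarrow> norm ((x + y) /\<^sub>R 2) \<le> 1 - \<delta>))"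

definition uniformly_smooth :: "'x::real_normed_vector itself \<Rightarrow> bool" where
  "uniformly_smooth _ \<longleftrightarrow>
     (\<forall>\<epsilon>>0. \<exists>\<delta>>0. \<forall>x y :: 'x. norm x = 1 \<and> norm y \<le> \<delta>
          \<longrightarrow> norm (x + y) + norm (x - y) \<le> 2 + \<epsilon> * norm y)"

section \<open>Bochner spaces\<close>

text \<open>
  Strong measurability is almost everywhere approximability by simple functions supported on sets
  of finite measure. Borel measurability would be too weak for it, as the Banach space need not be
  separable. For the same reason the Bochner integral of the library, which requires a
  second countable space, is used for real integrands only.
\<close>

definition strongly_measurable :: "'s measure \<Rightarrow> ('s \<Rightarrow> 'x::real_normed_vector) \<Rightarrow> bool" where
  "strongly_measurable M f \<longleftrightarrow>
     (\<exists>u. (\<forall>n. Bochner_Integration.simple_bochner_integrable M (u n)) \<and>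
          (AE s in M. (\<lambda>n. u n s) \<longlonglongrightarrow> f s))"

definition Lp_fun :: "'s measure \<Rightarrow> real \<Rightarrow> ('s \<Rightarrow> 'x::real_normed_vector) set" where
  "Lp_fun M p = {f. strongly_measurable M f \<and> integrable M (\<lambda>s. norm (f s) powr p)}"

definition Lp_class ::
    "'s measure \<Rightarrow> real \<Rightarrow> ('s \<Rightarrow> 'x::real_normed_vector) \<Rightarrow> ('s \<Rightarrow> 'x) set" where
  "Lp_class M p f = {g \<in> Lp_fun M p. AE s in M. g s = f s}"

text \<open>The elements of the Bochner space are equivalence classes, represented as sets of functions.\<close>

definition Lp :: "'s measure \<Rightarrow> real \<Rightarrow> ('s \<Rightarrow> 'x::real_normed_vector) set set" where
  "Lp M p = Lp_class M p ` Lp_fun M p"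

definition rep :: "('s \<Rightarrow> 'x) set \<Rightarrow> 's \<Rightarrow> 'x" where
  "rep F = (SOME f. f \<in> F)"

definition Lp_zero :: "'s measure \<Rightarrow> real \<Rightarrow> ('s \<Rightarrow> 'x::real_normed_vector) set" where
  "Lp_zero M p = Lp_class M p (\<lambda>_. 0)"

definition Lp_diff :: "'s measure \<Rightarrow> real \<Rightarrow> ('s \<Rightarrow> 'x::real_normed_vector) set
    \<Rightarrow> ('s \<Rightarrow> 'x) set \<Rightarrow> ('s \<Rightarrow> 'x) set" where
  "Lp_diff M p F G = Lp_class M p (\<lambda>s. rep F s - rep G s)"

definition Lp_scale :: "'s measure \<Rightarrow> real \<Rightarrow> real \<Rightarrow> ('s \<Rightarrow> 'x::real_normed_vector) set
    \<Rightarrow> ('s \<Rightarrow> 'x) set" where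
  "Lp_scale M p c F = Lp_class M p (\<lambda>s. c *\<^sub>R rep F s)"

definition Lp_norm :: "'s measure \<Rightarrow> real \<Rightarrow> ('s \<Rightarrow> 'x::real_normed_vector) set \<Rightarrow> real" where
  "Lp_norm M p F = (\<integral>s. norm (rep F s) powr p \<partial>M) powr (1 / p)"

definition Lp_cball :: "'s measure \<Rightarrow> real \<Rightarrow> real \<Rightarrow> ('s \<Rightarrow> 'x::real_normed_vector) set set" where
  "Lp_cball M p r = {F \<in> Lp M p. Lp_norm M p (Lp_diff M p F (Lp_zero M p)) \<le> r}"

definition pairing :: "'s measure \<Rightarrow> ('s \<Rightarrow> ('x::real_normed_vector \<Rightarrow>\<^sub>L real)) set
    \<Rightarrow> ('s \<Rightarrow> 'x) set \<Rightarrow> real" where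
  "pairing M \<Phi> F = (\<integral>s. blinfun_apply (rep \<Phi> s) (rep F s) \<partial>M)"

section \<open>Normalized duality mappings\<close>

text \<open>
  The duality mapping of a space with norm \<open>nY\<close> whose dual is represented by the set \<open>D\<close> with
  norm \<open>nD\<close> through the pairing \<open>pr\<close>.
\<close>

definition duality_map ::
    "'d set \<Rightarrow> ('d \<Rightarrow> real) \<Rightarrow> ('y \<Rightarrow> real) \<Rightarrow> ('d \<Rightarrow> 'y \<Rightarrow> real) \<Rightarrow> 'y \<Rightarrow> 'd" where
  "duality_map D nD nY pr y =
     (THE j. j \<in> D \<and> pr j y = nD j * nY y \<and> nD j * nY y = (nY y)\<^sup>2 \<and> (nY y)\<^sup>2 = (nD j)\<^sup>2)"

text \<open>
  Under the isometric identifications given by the pairing, the dual of \<open>L\<^sub>p(S;X)\<close> is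
  \<open>L\<^sub>q(S;X\<^sup>*)\<close>, and by reflexivity the dual of \<open>L\<^sub>q(S;X\<^sup>*)\<close> is \<open>L\<^sub>p(S;X)\<close>.
\<close>

definition Jp :: "'s measure \<Rightarrow> real \<Rightarrow> real \<Rightarrow> ('s \<Rightarrow> 'x::real_normed_vector) set
    \<Rightarrow> ('s \<Rightarrow> ('x \<Rightarrow>\<^sub>L real)) set" where
  "Jp M p q = duality_map (Lp M q) (Lp_norm M q) (Lp_norm M p) (pairing M)"

definition Jq_star :: "'s measure \<Rightarrow> real \<Rightarrow> real \<Rightarrow> ('s \<Rightarrow> ('x::real_normed_vector \<Rightarrow>\<^sub>L real)) set
    \<Rightarrow> ('s \<Rightarrow> 'x) set" where
  "Jq_star M p q = duality_map (Lp M p) (Lp_norm M p) (Lp_norm M q) (\<lambda>F \<Phi>. pairing M \<Phi> F)"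

section \<open>Projections\<close>

definition metric_proj :: "'s measure \<Rightarrow> real \<Rightarrow> ('s \<Rightarrow> 'x::real_normed_vector) set set
    \<Rightarrow> ('s \<Rightarrow> 'x) set \<Rightarrow> ('s \<Rightarrow> 'x) set" where
  "metric_proj M p C g =
     (THE h. h \<in> C \<and> (\<forall>z\<in>C. Lp_norm M p (Lp_diff M p g h) \<le> Lp_norm M p (Lp_diff M p g z)))"

definition lyapunov_V :: "'s measure \<Rightarrow> real \<Rightarrow> real \<Rightarrow> ('s \<Rightarrow> ('x::real_normed_vector \<Rightarrow>\<^sub>L real)) set
    \<Rightarrow> ('s \<Rightarrow> 'x) set \<Rightarrow> real" where
  "lyapunov_V M p q \<phi> f = (Lp_norm M q \<phi>)\<^sup>2 - 2 * pairing M \<phi> f + (Lp_norm M p f)\<^sup>2"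

definition gen_proj :: "'s measure \<Rightarrow> real \<Rightarrow> real \<Rightarrow> ('s \<Rightarrow> 'x::real_normed_vector) set set
    \<Rightarrow> ('s \<Rightarrow> ('x \<Rightarrow>\<^sub>L real)) set \<Rightarrow> ('s \<Rightarrow> 'x) set" where
  "gen_proj M p q C \<phi> =
     (THE h. h \<in> C \<and> lyapunov_V M p q \<phi> h = (INF f\<in>C. lyapunov_V M p q \<phi> f))"

definition gen_metric_proj :: "'s measure \<Rightarrow> real \<Rightarrow> real \<Rightarrow> ('s \<Rightarrow> 'x::real_normed_vector) set set
    \<Rightarrow> ('s \<Rightarrow> 'x) set \<Rightarrow> ('s \<Rightarrow> 'x) set" where
  "gen_metric_proj M p q C g = gen_proj M p q C (Jp M p q g)"

end

theory Submission
  imports Defs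
begin

text \<open>
  Everything is a consequence of Hoelder's inequality
  \<open>\<langle>\<phi>, f\<rangle> \<le> \<parallel>\<phi>\<parallel> \<parallel>f\<parallel>\<close> and of the fact that, for a given \<open>\<phi> \<noteq> 0\<close>, there is exactly one \<open>f\<close> of
  each prescribed norm that attains it.

  Put \<open>n = \<parallel>\<phi>\<parallel>\<close>. By Hoelder, \<open>V(\<phi>, f) \<ge> (n - \<parallel>f\<parallel>)\<^sup>2\<close>, and on the ball of radius \<open>r\<close> this is at least
  \<open>(n - min n r)\<^sup>2\<close>. The bound is attained exactly by the \<open>f\<close> with \<open>\<parallel>f\<parallel> = min n r\<close> and
  \<open>\<langle>\<phi>, f\<rangle> = n \<parallel>f\<parallel>\<close>, hence by a multiple of \<open>J\<^sub>q\<^sup>* \<phi>\<close>; this is the generalized projection. Since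
  \<open>J\<^sub>q\<^sup>*\<close> inverts \<open>J\<^sub>p\<close>, taking \<open>\<phi> = J\<^sub>p g\<close> yields the generalized metric projection. For the
  metric projection of a point \<open>g\<close> outside the ball, \<open>\<phi> = J\<^sub>p g\<close> serves as the supporting functional:
  \<open>\<parallel>g\<parallel>\<^sup>2 = \<langle>\<phi>, g - z\<rangle> + \<langle>\<phi>, z\<rangle> \<le> \<parallel>g\<parallel> (\<parallel>g - z\<parallel> + \<parallel>z\<parallel>)\<close>, and equality forces \<open>z\<close> to be the element of
  norm \<open>r\<close> that \<open>\<phi>\<close> norms, so \<open>z\<close> is a multiple of \<open>g\<close>.

  It remains to see that norming elements in Bochner spaces exist and are unique. Equality in
  Hoelder's inequality holds only if it holds pointwise, so both questions descend to \<open>X\<close>. There,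
  uniform convexity and completeness give each nonzero functional exactly one norming unit vector,
  and uniform smoothness gives each unit vector exactly one norming functional of norm one; in both
  cases the dependence is continuous on the unit sphere, which is what preserves strong measurability when the pointwise duality map is
  composed with a class. The two directions are treated at once through the notion \<open>norming_map\<close>
  of a contractive bilinear form with such a selection, instantiated with \<open>f, x \<mapsto> f x\<close> and with
  \<open>x, f \<mapsto> f x\<close>.
\<close>

section \<open>Norming maps\<close>

text \<open>
  On unit spheres, \<open>u x\<close> is the only point at which \<open>B x\<close> attains the bound that contractivity
  allows: \<open>u\<close> is the normalized duality mapping of the first space, seen through \<open>B\<close>.
\<close>

definition norming_map :: "('a::real_normed_vector \<Rightarrow> 'b::real_normed_vector \<Rightarrow> real) \<Rightarrow> ('a \<Rightarrow> 'b) \<Rightarrow> bool" where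
  "norming_map B u \<longleftrightarrow>
     bounded_bilinear B \<and> (\<forall>x y. \<bar>B x y\<bar> \<le> norm x * norm y) \<and> continuous_on (sphere 0 1) u \<and>
     (\<forall>x. norm x = 1 \<longrightarrow> (\<forall>y. norm y = 1 \<and> B x y = 1 \<longleftrightarrow> y = u x))"

text \<open>
  Stability of norming vectors contains both uniqueness (take two norming vectors of the same point)
  and uniform continuity of the resulting selection.
\<close>

lemma norming_mapI:
  fixes B :: "'a::real_normed_vector \<Rightarrow> 'b::real_normed_vector \<Rightarrow> real"
  assumes "bounded_bilinear B"
    and "\<And>x y. \<bar>B x y\<bar> \<le> norm x * norm y"
    and ex: "\<And>x. norm x = 1 \<Longrightarrow> \<exists>y. norm y = 1 \<and> B x y = 1"
    and stable: "\<And>\<epsilon>. \<epsilon> > 0 \<Longrightarrow> \<exists>\<delta>>0. \<forall>x x' y y'. norm x = 1 \<and> norm x' = 1 \<and> norm y = 1 \<and> norm y' = 1 \<and>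
        B x y = 1 \<and> B x' y' = 1 \<and> norm (x - x') < \<delta> \<longrightarrow> norm (y - y') < \<epsilon>"
  shows "\<exists>u. norming_map B u"
proof -
  define u where "u x = (SOME y. norm y = 1 \<and> B x y = 1)" for x
  have u: "norm (u x) = 1 \<and> B x (u x) = 1" if "norm x = 1" for x
    unfolding u_def by (rule someI_ex) (rule ex[OF that])
  have uniq: "y = u x" if "norm x = 1" "norm y = 1" "B x y = 1" for x y
  proof (rule ccontr)
    assume "y \<noteq> u x"
    then have "norm (y - u x) > 0" by simp
    then obtain \<delta> where "\<delta> > 0" and *: "\<forall>x1 x' y1 y'. norm x1 = 1 \<and> norm x' = 1 \<and> norm y1 = 1 \<and> norm y' = 1 \<and>
        B x1 y1 = 1 \<and> B x' y' = 1 \<and> norm (x1 - x') < \<delta> \<longrightarrow> norm (y1 - y') < norm (y - u x)"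
      using stable by blast
    have "norm (y - u x) < norm (y - u x)"
      by (rule *[rule_format, of x x]) (use that u \<open>\<delta> > 0\<close> in auto)
    then show False by simp
  qed
  have "continuous_on (sphere 0 1) u"
    unfolding continuous_on_iff dist_norm
  proof (intro ballI allI impI)
    fix x :: 'a and \<epsilon> :: real assume x: "x \<in> sphere 0 1" and "\<epsilon> > 0"
    from stable[OF \<open>\<epsilon> > 0\<close>] obtain \<delta> where "\<delta> > 0"
      and *: "\<forall>x x' y y'. norm x = 1 \<and> norm x' = 1 \<and> norm y = 1 \<and> norm y' = 1 \<and>
        B x y = 1 \<and> B x' y' = 1 \<and> norm (x - x') < \<delta> \<longrightarrow> norm (y - y') < \<epsilon>" by blast
    have "norm (u x' - u x) < \<epsilon>" if "x' \<in> sphere 0 1" "norm (x' - x) < \<delta>" for x'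
      by (rule *[rule_format, of x' x]) (use that x u[of x] u[of x'] in auto)
    then show "\<exists>d>0. \<forall>x'\<in>sphere 0 1. norm (x' - x) < d \<longrightarrow> norm (u x' - u x) < \<epsilon>"
      using \<open>\<delta> > 0\<close> by blast
  qed
  then have "norming_map B u"
    unfolding norming_map_def using assms(1,2) u uniq by blast
  then show ?thesis by blast
qed

lemma uniformly_convexD:
  assumes "uniformly_convex TYPE('x::real_normed_vector)" "\<epsilon> > 0"
  obtains \<delta> where "\<delta> > 0"
    "\<And>x y :: 'x. norm x = 1 \<Longrightarrow> norm y = 1 \<Longrightarrow> norm (x + y) > 2 - \<delta> \<Longrightarrow> norm (x - y) < \<epsilon>"
proof -
  have "0 < min \<epsilon> 2 \<and> min \<epsilon> 2 \<le> 2" using assms by auto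
  then obtain \<delta> where "\<delta> > 0" and *: "\<forall>x y :: 'x. norm x = 1 \<and> norm y = 1 \<and> norm (x - y) \<ge> min \<epsilon> 2
          \<longrightarrow> norm ((x + y) /\<^sub>R 2) \<le> 1 - \<delta>"
    using assms(1) unfolding uniformly_convex_def by blast
  show thesis
  proof (rule that[of "2 * \<delta>"])
    fix x y :: 'x assume "norm x = 1" "norm y = 1" "norm (x + y) > 2 - 2 * \<delta>"
    then have "\<not> norm (x - y) \<ge> min \<epsilon> 2"
      using *[rule_format, of x y] by (auto simp: norm_scaleR)
    then show "norm (x - y) < \<epsilon>" by linarith
  qed (use \<open>\<delta> > 0\<close> in simp)
qed

lemma blinfun_near_norming:
  fixes f :: "'x::real_normed_vector \<Rightarrow>\<^sub>L real"
  assumes "norm f = 1" "\<delta> > 0"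
  shows "\<exists>x. norm x = 1 \<and> f x > 1 - \<delta>"
proof (rule ccontr)
  assume *: "\<not> ?thesis"
  define K where "K = max 0 (1 - \<delta>)"
  have "norm (f x) \<le> K * norm x" for x
  proof (cases "x = 0")
    case False
    have "f (x /\<^sub>R norm x) \<le> K" "f ((-x) /\<^sub>R norm x) \<le> K"
      using * False unfolding K_def by (force simp: norm_scaleR not_less dest: spec[of _ "x /\<^sub>R norm x"], 
         force simp: norm_scaleR not_less dest: spec[of _ "(-x) /\<^sub>R norm x"])
    then have "f x / norm x \<le> K" "- f x / norm x \<le> K"
      by (simp_all add: blinfun.scaleR_right blinfun.minus_right divide_inverse mult.commute)
    then show ?thesis using False by (auto simp: abs_if field_simps)
  qed simp
  then have "norm f \<le> K" by (intro norm_blinfun_bound) (auto simp: K_def)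
  then show False using assms by (auto simp: K_def)
qed

text \<open>
  Unit vectors at which a functional of norm one is nearly \<open>1\<close> have midpoints of norm nearly \<open>1\<close>, so
  uniform convexity brings them close to each other. Hence a maximizing sequence is Cauchy and its
  limit is a norming vector. The same estimate compares the norming vectors of nearby functionals.
\<close>

lemma uniformly_convex_norming_map:
  assumes "uniformly_convex TYPE('x::banach)"
  shows "\<exists>u. norming_map (blinfun_apply :: ('x \<Rightarrow>\<^sub>L real) \<Rightarrow> 'x \<Rightarrow> real) u"
proof (rule norming_mapI)
  show "bounded_bilinear (blinfun_apply :: ('x \<Rightarrow>\<^sub>L real) \<Rightarrow> 'x \<Rightarrow> real)"
    by (rule blinfun.bounded_bilinear_axioms)
  have bd: "\<bar>blinfun_apply f x\<bar> \<le> norm f * norm x" for f :: "'x \<Rightarrow>\<^sub>L real" and x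
    using norm_blinfun[of f x] by simp
  then show "\<bar>blinfun_apply f x\<bar> \<le> norm f * norm x" for f :: "'x \<Rightarrow>\<^sub>L real" and x .
  show "\<exists>x. norm x = 1 \<and> blinfun_apply f x = 1" if f: "norm f = 1" for f :: "'x \<Rightarrow>\<^sub>L real"
  proof -
    have "\<forall>n. \<exists>x. norm x = 1 \<and> f x > 1 - 1 / real (Suc n)"
      using blinfun_near_norming[OF f] by (auto simp del: of_nat_Suc)
    then obtain X where X: "\<And>n. norm (X n) = 1" "\<And>n. f (X n) > 1 - 1 / real (Suc n)"
      by metis
    have "Cauchy X"
      unfolding Cauchy_def dist_norm
    proof (intro allI impI)
      fix \<epsilon> :: real assume "\<epsilon> > 0"
      obtain \<delta> where "\<delta> > 0" and \<delta>:
        "\<And>x y :: 'x. norm x = 1 \<Longrightarrow> norm y = 1 \<Longrightarrow> norm (x + y) > 2 - \<delta> \<Longrightarrow> norm (x - y) < \<epsilon>"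
        using uniformly_convexD[OF assms \<open>\<epsilon> > 0\<close>] by blast
      obtain N where N: "1 / real (Suc N) < \<delta> / 2"
        using nat_approx_posE[of "\<delta> / 2"] \<open>\<delta> > 0\<close> by auto
      have big: "f (X n) > 1 - \<delta> / 2" if "n \<ge> N" for n
      proof -
        have "1 / real (Suc n) \<le> 1 / real (Suc N)" using that by (simp add: frac_le)
        then show ?thesis using X(2)[of n] N by linarith
      qed
      have "norm (X m - X n) < \<epsilon>" if "m \<ge> N" "n \<ge> N" for m n
      proof (rule \<delta>)
        have "2 - \<delta> < f (X m + X n)" 
          using big that by (simp add: blinfun.add_right) (smt (verit) field_sum_of_halves)
        also have "\<dots> \<le> norm (X m + X n)" using bd[of f "X m + X n"] f by simp
        finally show "2 - \<delta> < norm (X m + X n)" .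
      qed (use X in auto)
      then show "\<exists>M. \<forall>m\<ge>M. \<forall>n\<ge>M. norm (X m - X n) < \<epsilon>" by blast
    qed
    then obtain x where x: "X \<longlonglongrightarrow> x" using Cauchy_convergent convergent_def by blast
    have "norm x = 1"
      using tendsto_norm[OF x] X(1) by (simp add: LIMSEQ_const_iff)
    moreover have "f x \<ge> 1"
    proof (rule LIMSEQ_le)
      show "(\<lambda>n. f (X n)) \<longlonglongrightarrow> f x" using x by (intro tendsto_intros)
      show "(\<lambda>n. 1 - 1 / real (Suc n)) \<longlonglongrightarrow> 1"
        using tendsto_diff[OF tendsto_const LIMSEQ_inverse_real_of_nat, of 1] by (simp add: inverse_eq_divide)
    qed (use X(2) less_imp_le in blast)
    ultimately show ?thesis using bd[of f x] f by (intro exI[of _ x]) auto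
  qed
  show "\<exists>\<delta>>0. \<forall>(f :: 'x \<Rightarrow>\<^sub>L real) f' x x'. norm f = 1 \<and> norm f' = 1 \<and> norm x = 1 \<and> norm x' = 1 \<and>
        blinfun_apply f x = 1 \<and> blinfun_apply f' x' = 1 \<and> norm (f - f') < \<delta> \<longrightarrow> norm (x - x') < \<epsilon>"
    if "\<epsilon> > 0" for \<epsilon> :: real
  proof -
    obtain \<delta> where "\<delta> > 0" and \<delta>:
        "\<And>x y :: 'x. norm x = 1 \<Longrightarrow> norm y = 1 \<Longrightarrow> norm (x + y) > 2 - \<delta> \<Longrightarrow> norm (x - y) < \<epsilon>"
      using uniformly_convexD[OF assms \<open>\<epsilon> > 0\<close>] by blast
    have "norm (x - x') < \<epsilon>" if "norm f = 1" "norm x = 1" "norm x' = 1"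
        "f x = 1" "f' x' = 1" "norm (f - f') < \<delta>" for f f' :: "'x \<Rightarrow>\<^sub>L real" and x x'
    proof (rule \<delta>)
      have "f (x + x') = 2 + (f - f') x'"
        using that by (simp add: blinfun.add_right blinfun.diff_left)
      moreover have "\<bar>(f - f') x'\<bar> < \<delta>" using bd[of "f - f'" x'] that by simp
      ultimately have "2 - \<delta> < f (x + x')" by linarith
      also have "\<dots> \<le> norm (x + x')" using bd[of f "x + x'"] that by simp
      finally show "2 - \<delta> < norm (x + x')" .
    qed (use that in auto)
    then show ?thesis using \<open>\<delta> > 0\<close> by blast
  qed
qed

lemma uniformly_smoothD:
  assumes "uniformly_smooth TYPE('x::real_normed_vector)" "\<epsilon> > 0"
  obtains \<delta> where "\<delta> > 0"
    "\<And>x y :: 'x. norm x = 1 \<Longrightarrow> norm y \<le> \<delta> \<Longrightarrow> norm (x + y) + norm (x - y) \<le> 2 + \<epsilon> * norm y"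
  using assms unfolding uniformly_smooth_def by blast

text \<open>
  The one-sided derivative of the norm at \<open>x\<close>, written as an infimum of difference quotients, is
  sublinear for any norm. Smoothness makes the derivatives in the directions \<open>y\<close> and \<open>- y\<close> cancel,
  which turns it into a linear functional of norm one with value \<open>1\<close> at \<open>x\<close>.
\<close>

lemma uniformly_smooth_norming_functional:
  fixes x :: "'x::real_normed_vector"
  assumes us: "uniformly_smooth TYPE('x)" and x: "norm x = 1"
  shows "\<exists>f :: 'x \<Rightarrow>\<^sub>L real. norm f = 1 \<and> blinfun_apply f x = 1"
proof -
  define Q where "Q t y = (norm (x + t *\<^sub>R y) - 1) / t" for t :: real and y
  define D where "D y = (INF t\<in>{0<..}. Q t y)" for y
  have low: "- norm y \<le> Q t y" if "t > 0" for t y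
  proof -
    have "1 - t * norm y \<le> norm (x + t *\<^sub>R y)"
      using norm_diff_triangle_ineq[of x "t *\<^sub>R y"] norm_triangle_ineq4[of "x + t *\<^sub>R y" "t *\<^sub>R y"] that x by simp
    then show ?thesis using that by (simp add: Q_def field_simps)
  qed
  have DQ: "D y \<le> Q t y" if "t > 0" for t y
    unfolding D_def by (rule cINF_lower) (use that low in \<open>auto intro!: bdd_belowI2\<close>)
  have Dge: "c \<le> D y" if "\<And>t. t > 0 \<Longrightarrow> c \<le> Q t y" for c y
    unfolding D_def by (rule cINF_greatest) (use that in auto)
  have sub: "D (y + z) \<le> D y + D z" for y z
  proof -
    have "D (y + z) \<le> Q a y + Q b z" if ab: "a > 0" "b > 0" for a b
    proof -
      \<comment> \<open>The step with \<open>1 / t = 1 / a + 1 / b\<close> makes \<open>x + t (y + z)\<close> a convex combination of the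
        points \<open>x + a y\<close> and \<open>x + b z\<close>.\<close>
      define t where "t = a * b / (a + b)"
      have t: "t > 0" "t / a + t / b = 1"
        using ab by (simp_all add: t_def divide_simps)
      have "x + t *\<^sub>R (y + z) = (t / a) *\<^sub>R (x + a *\<^sub>R y) + (t / b) *\<^sub>R (x + b *\<^sub>R z)"
        using t ab by (simp add: algebra_simps flip: scaleR_add_left)
      then have "norm (x + t *\<^sub>R (y + z)) \<le> t / a * norm (x + a *\<^sub>R y) + t / b * norm (x + b *\<^sub>R z)"
        using norm_triangle_ineq[of "(t / a) *\<^sub>R (x + a *\<^sub>R y)" "(t / b) *\<^sub>R (x + b *\<^sub>R z)"] t ab by simp
      then have "norm (x + t *\<^sub>R (y + z)) - 1 \<le> t * (Q a y + Q b z)"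
        using t by (simp add: Q_def diff_divide_distrib algebra_simps)
      then have "Q t (y + z) \<le> Q a y + Q b z"
        using t unfolding Q_def[of t] by (simp add: field_simps)
      with DQ[OF t(1), of "y + z"] show ?thesis by linarith
    qed
    then have "D (y + z) - Q a y \<le> D z" if "a > 0" for a
      using that by (intro Dge) (smt (verit))
    then have "D (y + z) - D z \<le> D y" by (intro Dge) (smt (verit))
    then show ?thesis by simp
  qed
  have zero: "D 0 = 0"
    using x by (simp add: D_def Q_def)
  have odd: "D (- y) = - D y" for y
  proof -
    have "D y + D (- y) \<le> 0 + \<epsilon>" if "\<epsilon> > 0" for \<epsilon>
    proof -
      define \<epsilon>' where "\<epsilon>' = \<epsilon> / (norm y + 1)"
      have "\<epsilon>' > 0" using that by (simp add: \<epsilon>'_def add_nonneg_pos)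
      then obtain \<delta> where "\<delta> > 0" and \<delta>: "\<And>x y :: 'x. norm x = 1 \<Longrightarrow> norm y \<le> \<delta> \<Longrightarrow>
          norm (x + y) + norm (x - y) \<le> 2 + \<epsilon>' * norm y"
        using uniformly_smoothD[OF us] by blast
      define t where "t = \<delta> / (norm y + 1)"
      have "t > 0" using \<open>\<delta> > 0\<close> by (simp add: t_def add_nonneg_pos)
      have "norm (t *\<^sub>R y) \<le> \<delta>" using \<open>\<delta> > 0\<close> by (simp add: t_def divide_le_eq add_nonneg_pos mult_left_mono)
      have "Q t y + Q t (- y) = (norm (x + t *\<^sub>R y) + norm (x - t *\<^sub>R y) - 2) / t"
        by (simp add: Q_def add_divide_distrib diff_divide_distrib)
      also have "\<dots> \<le> \<epsilon>' * norm y"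
        using \<delta>[OF x \<open>norm (t *\<^sub>R y) \<le> \<delta>\<close>] \<open>t > 0\<close> by (simp add: divide_le_eq mult_ac)
      also have "\<dots> \<le> \<epsilon>" using that by (simp add: \<epsilon>'_def divide_le_eq add_nonneg_pos mult_left_mono)
      finally show ?thesis using DQ[OF \<open>t > 0\<close>, of y] DQ[OF \<open>t > 0\<close>, of "- y"] by linarith
    qed
    then have "D y + D (- y) \<le> 0" by (rule field_le_epsilon)
    with sub[of y "- y"] zero show ?thesis by simp
  qed
  have add: "D (y + z) = D y + D z" for y z
    using sub[of y z] sub[of "- y" "- z"] odd[of y] odd[of z] odd[of "y + z"] by simp
  have scale_le: "D (c *\<^sub>R y) \<le> c * D y" if "c > 0" for c y
  proof -
    have "D (c *\<^sub>R y) / c \<le> D y"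
    proof (rule Dge)
      fix t :: real assume "t > 0"
      have "D (c *\<^sub>R y) \<le> Q (t / c) (c *\<^sub>R y)" using that \<open>t > 0\<close> by (intro DQ) simp
      also have "\<dots> = c * Q t y" using that \<open>t > 0\<close> by (simp add: Q_def)
      finally show "D (c *\<^sub>R y) / c \<le> Q t y" using that by (simp add: field_simps)
    qed
    then show ?thesis using that by (simp add: field_simps)
  qed
  have scale_pos: "D (c *\<^sub>R y) = c * D y" if "c > 0" for c y
    using scale_le[OF that, of y] scale_le[of "1 / c" "c *\<^sub>R y"] that by (simp add: field_simps)
  have scale: "D (c *\<^sub>R y) = c * D y" for c y
  proof (cases c "0::real" rule: linorder_cases)
    case less
    then show ?thesis using scale_pos[of "- c" y] odd[of "c *\<^sub>R y"] by simp
  qed (use zero scale_pos in auto)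
  have up: "D y \<le> norm y" for y
    using DQ[of 1 y] norm_triangle_ineq[of x y] x by (simp add: Q_def)
  have bound: "norm (D y) \<le> norm y * 1" for y
    using up[of y] up[of "- y"] odd[of y] by simp
  have "D x = 1"
  proof -
    have "x + t *\<^sub>R x = (1 + t) *\<^sub>R x" for t :: real by (simp add: algebra_simps)
    then have "Q t x = 1" if "t > 0" for t using x that by (simp add: Q_def)
    then show ?thesis by (simp add: D_def)
  qed
  have "bounded_linear D"
    by (rule bounded_linear_intro[OF _ _ bound]) (simp_all add: add scale)
  then have f: "blinfun_apply (Blinfun D) = D" by (rule bounded_linear_Blinfun_apply)
  have "norm (Blinfun D) \<le> 1"
    by (rule norm_blinfun_bound) (use bound f in auto)
  moreover have "norm (Blinfun D) \<ge> 1"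
    using norm_blinfun[of "Blinfun D" x] f \<open>D x = 1\<close> x by simp
  ultimately show ?thesis using f \<open>D x = 1\<close> by (intro exI[of _ "Blinfun D"]) auto
qed

text \<open>
  If \<open>f\<close> norms \<open>x\<close> and \<open>f'\<close> norms \<open>x'\<close>, then
  \<open>(f - f') z = f (x + z) + f' (x - z) - 2 + f' (x' - x)\<close>, and smoothness bounds the right-hand side by
  a small multiple of \<open>\<parallel>z\<parallel>\<close> plus \<open>\<parallel>x - x'\<parallel>\<close>.
\<close>

lemma uniformly_smooth_norming_map:
  assumes us: "uniformly_smooth TYPE('x::real_normed_vector)"
  shows "\<exists>u. norming_map (\<lambda>(x::'x) (f :: 'x \<Rightarrow>\<^sub>L real). blinfun_apply f x) u"
proof (rule norming_mapI)
  show "bounded_bilinear (\<lambda>(x::'x) (f :: 'x \<Rightarrow>\<^sub>L real). blinfun_apply f x)"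
    by (rule bounded_bilinear.flip[OF blinfun.bounded_bilinear_axioms])
  have bd: "\<bar>blinfun_apply f x\<bar> \<le> norm f * norm x" for f :: "'x \<Rightarrow>\<^sub>L real" and x
    using norm_blinfun[of f x] by simp
  then show "\<bar>blinfun_apply f x\<bar> \<le> norm x * norm f" for f :: "'x \<Rightarrow>\<^sub>L real" and x 
    by (simp add: mult.commute)
  show "\<exists>f :: 'x \<Rightarrow>\<^sub>L real. norm f = 1 \<and> blinfun_apply f x = 1" if "norm x = 1" for x
    by (rule uniformly_smooth_norming_functional[OF us that])
  show "\<exists>\<delta>>0. \<forall>x x' (f :: 'x \<Rightarrow>\<^sub>L real) f'. norm x = 1 \<and> norm x' = 1 \<and> norm f = 1 \<and> norm f' = 1 \<and>
        blinfun_apply f x = 1 \<and> blinfun_apply f' x' = 1 \<and> norm (x - x') < \<delta> \<longrightarrow> norm (f - f') < \<epsilon>"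
    if "\<epsilon> > 0" for \<epsilon> :: real
  proof -
    have "\<epsilon> / 3 > 0" using that by simp
    then obtain \<delta> where "\<delta> > 0" and \<delta>: "\<And>x y :: 'x. norm x = 1 \<Longrightarrow> norm y \<le> \<delta> \<Longrightarrow>
          norm (x + y) + norm (x - y) \<le> 2 + \<epsilon> / 3 * norm y"
      using uniformly_smoothD[OF us] by blast
    have "norm (f - f') < \<epsilon>" if "norm x = 1" "norm f = 1" "norm f' = 1"
        "f x = 1" "f' x' = 1" "norm (x - x') < \<epsilon> / 3 * \<delta>" for f f' :: "'x \<Rightarrow>\<^sub>L real" and x x'
    proof -
      have small: "(f - f') z \<le> 2 * \<epsilon> / 3 * \<delta>" if "norm z = \<delta>" for z
      proof -
        have "(f - f') z = f (x + z) + f' (x - z) - 2 + f' (x' - x)"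
          using \<open>f x = 1\<close> \<open>f' x' = 1\<close> by (simp add: blinfun.add_right blinfun.diff_left blinfun.diff_right)
        moreover have "f (x + z) \<le> norm (x + z)" "f' (x - z) \<le> norm (x - z)" "f' (x' - x) \<le> norm (x - x')"
          using bd[of f "x + z"] bd[of f' "x - z"] bd[of f' "x' - x"] \<open>norm f = 1\<close> \<open>norm f' = 1\<close>
          by (simp_all add: norm_minus_commute)
        ultimately show ?thesis
          using \<delta>[OF \<open>norm x = 1\<close>, of z] that \<open>norm (x - x') < _\<close> by simp
      qed
      have "norm ((f - f') y) \<le> 2 * \<epsilon> / 3 * norm y" for y
      proof (cases "y = 0")
        case False
        define t where "t = \<delta> / norm y"
        have "t > 0" using False \<open>\<delta> > 0\<close> by (simp add: t_def)
        have "norm (t *\<^sub>R y) = \<delta>" "norm (- t *\<^sub>R y) = \<delta>" using False \<open>\<delta> > 0\<close> by (simp_all add: t_def)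
        from this[THEN small] have "t * \<bar>(f - f') y\<bar> \<le> 2 * \<epsilon> / 3 * \<delta>"
          unfolding scaleR_minus_left blinfun.minus_right blinfun.scaleR_right by (auto simp: abs_if)
        also have "2 * \<epsilon> / 3 * \<delta> = t * (2 * \<epsilon> / 3 * norm y)"
          using False by (simp add: t_def)
        finally show ?thesis using \<open>t > 0\<close> by simp
      qed simp
      then have "norm (f - f') \<le> 2 * \<epsilon> / 3" using \<open>\<epsilon> > 0\<close> by (intro norm_blinfun_bound) auto
      then show ?thesis using \<open>\<epsilon> > 0\<close> by linarith
    qed
    then show ?thesis using \<open>\<delta> > 0\<close> \<open>\<epsilon> > 0\<close> by (intro exI[of _ "\<epsilon> / 3 * \<delta>"]) auto
  qed
qed

lemma norming_map_unique:
  assumes "norming_map B u" "x \<noteq> 0" "B x y = norm x * norm y"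
  shows "y = norm y *\<^sub>R u (sgn x)"
proof (cases "y = 0")
  case False
  interpret bounded_bilinear B using assms(1) by (simp add: norming_map_def)
  have "B (sgn x) (sgn y) = 1"
    using assms(2,3) False by (simp add: sgn_div_norm scaleR_left scaleR_right field_simps)
  moreover have "norm (sgn x) = 1" "norm (sgn y) = 1"
    using assms(2) False by (simp_all add: norm_sgn)
  ultimately have "sgn y = u (sgn x)"
    using assms(1) unfolding norming_map_def by blast
  moreover have "y = norm y *\<^sub>R sgn y" using False by (simp add: sgn_div_norm)
  ultimately show ?thesis by metis
qed simp

lemma norming_mapD:
  assumes "norming_map B u"
  shows "bounded_bilinear B" "\<bar>B x y\<bar> \<le> norm x * norm y" "norm x = 1 \<Longrightarrow> norm (u x) = 1"
    "norm x = 1 \<Longrightarrow> B x (u x) = 1" "continuous_on (sphere 0 1) u"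
  using assms unfolding norming_map_def by blast+

text \<open>
  The positively homogeneous extension of a norming map. A positive degree is what makes the
  extension continuous at the origin, where \<open>u (sgn x)\<close> alone need not have a limit.
\<close>

lemma norming_map_homogeneous:
  assumes u: "norming_map B u" and "c > 0"
  shows "norm (norm x powr c *\<^sub>R u (sgn x)) = norm x powr c"
    and "B x (norm x powr c *\<^sub>R u (sgn x)) = norm x powr (c + 1)"
    and "continuous_on UNIV (\<lambda>x. norm x powr c *\<^sub>R u (sgn x))"
proof -
  interpret bounded_bilinear B by (rule norming_mapD[OF u])
  show nm: "norm (norm x powr c *\<^sub>R u (sgn x)) = norm x powr c" for x
    by (cases "x = 0") (simp_all add: norming_mapD(3)[OF u] norm_sgn)
  show "B x (norm x powr c *\<^sub>R u (sgn x)) = norm x powr (c + 1)"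
  proof (cases "x = 0")
    case False
    have "B x (u (sgn x)) = B (norm x *\<^sub>R sgn x) (u (sgn x))" using False by (simp add: sgn_div_norm)
    also have "\<dots> = norm x" using norming_mapD(4)[OF u, of "sgn x"] False by (simp add: scaleR_left norm_sgn)
    finally show ?thesis by (simp add: scaleR_right powr_add)
  qed (simp add: zero_left)
  have off: "continuous_on (- {0}) (\<lambda>x. norm x powr c *\<^sub>R u (sgn x))"
    by (intro continuous_intros continuous_on_compose2[OF norming_mapD(5)[OF u]])
      (auto simp: norm_sgn split: if_splits)
  have at0: "((\<lambda>x. norm x powr c *\<^sub>R u (sgn x)) \<longlongrightarrow> 0) (at 0)"
  proof (rule tendsto_norm_zero_cancel)
    have "continuous_on UNIV (\<lambda>x. norm (x::'a) powr c)"
      using \<open>c > 0\<close> by (auto intro!: continuous_intros continuous_on_powr')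
    then have "isCont (\<lambda>x. norm (x::'a) powr c) 0"
      by (simp add: continuous_on_eq_continuous_at)
    then show "((\<lambda>x. norm (norm x powr c *\<^sub>R u (sgn x))) \<longlongrightarrow> 0) (at 0)"
      using \<open>c > 0\<close> unfolding nm isCont_def by simp
  qed
  have "isCont (\<lambda>x. norm x powr c *\<^sub>R u (sgn x)) x" for x
  proof (cases "x = 0")
    case True then show ?thesis using at0 by (simp add: isCont_def)
  next
    case False
    then show ?thesis using off by (simp add: continuous_on_eq_continuous_at open_Compl)
  qed
  then show "continuous_on UNIV (\<lambda>x. norm x powr c *\<^sub>R u (sgn x))"
    by (simp add: continuous_at_imp_continuous_on)
qed

section \<open>Strong measurability and Bochner classes\<close>

lemma strongly_measurable_compose2:
  fixes h :: "'a::real_normed_vector \<Rightarrow> 'b::real_normed_vector \<Rightarrow> 'c::real_normed_vector"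
  assumes "strongly_measurable M f" "strongly_measurable M g"
    and h: "continuous_on UNIV (\<lambda>z. h (fst z) (snd z))" "h 0 0 = 0"
  shows "strongly_measurable M (\<lambda>s. h (f s) (g s))"
proof -
  obtain u v where u: "\<And>n. Bochner_Integration.simple_bochner_integrable M (u n)" "AE s in M. (\<lambda>n. u n s) \<longlonglongrightarrow> f s"
    and v: "\<And>n. Bochner_Integration.simple_bochner_integrable M (v n)" "AE s in M. (\<lambda>n. v n s) \<longlonglongrightarrow> g s"
    using assms(1,2) unfolding strongly_measurable_def by blast
  have "AE s in M. (\<lambda>n. h (u n s) (v n s)) \<longlonglongrightarrow> h (f s) (g s)"
    using u(2) v(2)
  proof eventually_elim
    case (elim s)
    then have "(\<lambda>n. (u n s, v n s)) \<longlonglongrightarrow> (f s, g s)" by (intro tendsto_intros)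
    from continuous_on_tendsto_compose[OF h(1) this] show ?case by simp
  qed
  moreover have "Bochner_Integration.simple_bochner_integrable M (\<lambda>s. h (u n s) (v n s))" for n
    using simple_bochner_integrable_compose2[of h, OF h(2) u(1) v(1)] .
  ultimately show ?thesis
    unfolding strongly_measurable_def by (intro exI[of _ "\<lambda>n s. h (u n s) (v n s)"]) simp
qed

lemma strongly_measurable_compose:
  fixes h :: "'a::real_normed_vector \<Rightarrow> 'b::real_normed_vector"
  assumes "strongly_measurable M f" "continuous_on UNIV h" "h 0 = 0"
  shows "strongly_measurable M (\<lambda>s. h (f s))"
  by (rule strongly_measurable_compose2[where h = "\<lambda>x _. h x", OF assms(1,1)])
    (use assms(2,3) in \<open>auto intro!: continuous_intros intro: continuous_on_compose2\<close>)

text \<open>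
  Strong measurability only gives a limit almost everywhere; completeness of the measure absorbs the
  exceptional null set.
\<close>

lemma (in complete_measure) borel_measurable_if_strongly_measurable:
  fixes f :: "'a \<Rightarrow> real"
  assumes "strongly_measurable M f"
  shows "f \<in> borel_measurable M"
proof -
  obtain u where u: "\<And>n. Bochner_Integration.simple_bochner_integrable M (u n)"
    and lim: "AE s in M. (\<lambda>n. u n s) \<longlonglongrightarrow> f s"
    using assms unfolding strongly_measurable_def by blast
  have [measurable]: "u n \<in> borel_measurable M" for n
    using u[of n] by cases (rule borel_measurable_simple_function)
  define g where "g s = lim (\<lambda>n. u n s)" for s
  have g[measurable]: "g \<in> borel_measurable M" unfolding g_def by measurable
  have eq: "AE s in M. g s = f s" using lim unfolding g_def by eventually_elim (rule limI)
  show ?thesis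
  proof (rule measurableI)
    fix A :: "real set" assume "A \<in> sets borel"
    then have "g -` A \<inter> space M \<in> sets M" by (rule measurable_sets[OF g])
    moreover have "AE s in M. s \<in> g -` A \<inter> space M \<longleftrightarrow> s \<in> f -` A \<inter> space M"
      using eq by eventually_elim auto
    ultimately show "f -` A \<inter> space M \<in> sets M" by (auto intro: in_sets_AE[rotated])
  qed simp
qed

lemma Lp_funI:
  fixes f :: "'s \<Rightarrow> 'a::real_normed_vector"
  assumes "complete_measure M" "strongly_measurable M f" "integrable M w" "p > 0"
    and "AE s in M. norm (f s) powr p \<le> w s"
  shows "f \<in> Lp_fun M p"
proof -
  have "strongly_measurable M (\<lambda>s. norm (f s) powr p)"
    by (rule strongly_measurable_compose[OF assms(2)])
      (use \<open>p > 0\<close> in \<open>auto intro!: continuous_intros continuous_on_powr'\<close>)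
  then have "(\<lambda>s. norm (f s) powr p) \<in> borel_measurable M"
    by (rule complete_measure.borel_measurable_if_strongly_measurable[OF assms(1)])
  then have "integrable M (\<lambda>s. norm (f s) powr p)"
    by (rule Bochner_Integration.integrable_bound[OF assms(3)]) (use assms(5) in \<open>eventually_elim, auto\<close>)
  with assms(2) show ?thesis by (simp add: Lp_fun_def)
qed

lemma Lp_fun_diff:
  fixes f g :: "'s \<Rightarrow> 'a::real_normed_vector"
  assumes M: "complete_measure M" and p: "p > 0" and f: "f \<in> Lp_fun M p" and g: "g \<in> Lp_fun M p"
  shows "(\<lambda>s. f s - g s) \<in> Lp_fun M p"
proof (rule Lp_funI[OF M _ _ p])
  show "strongly_measurable M (\<lambda>s. f s - g s)"
    by (rule strongly_measurable_compose2[where h = "(-)"])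
      (use f g in \<open>auto simp: Lp_fun_def intro!: continuous_intros\<close>)
  show "integrable M (\<lambda>s. 2 powr p * (norm (f s) powr p + norm (g s) powr p))"
    using f g by (simp add: Lp_fun_def)
  show "AE s in M. norm (f s - g s) powr p \<le> 2 powr p * (norm (f s) powr p + norm (g s) powr p)"
  proof (rule AE_I2)
    fix s
    have "norm (f s - g s) \<le> 2 * max (norm (f s)) (norm (g s))"
      using norm_triangle_ineq4[of "f s" "g s"] by simp
    then have "norm (f s - g s) powr p \<le> (2 * max (norm (f s)) (norm (g s))) powr p"
      using p by (intro powr_mono2) auto
    also have "\<dots> = 2 powr p * max (norm (f s)) (norm (g s)) powr p" by (simp add: powr_mult)
    also have "\<dots> \<le> 2 powr p * (norm (f s) powr p + norm (g s) powr p)"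
      by (simp add: max_def)
    finally show "norm (f s - g s) powr p \<le> 2 powr p * (norm (f s) powr p + norm (g s) powr p)" .
  qed
qed

lemma Lp_fun_scale:
  fixes f :: "'s \<Rightarrow> 'a::real_normed_vector"
  assumes M: "complete_measure M" and p: "p > 0" and f: "f \<in> Lp_fun M p"
  shows "(\<lambda>s. c *\<^sub>R f s) \<in> Lp_fun M p"
proof (rule Lp_funI[OF M _ _ p])
  show "strongly_measurable M (\<lambda>s. c *\<^sub>R f s)"
    by (rule strongly_measurable_compose) (use f in \<open>auto simp: Lp_fun_def intro!: continuous_intros\<close>)
  show "integrable M (\<lambda>s. \<bar>c\<bar> powr p * norm (f s) powr p)"
    using f by (simp add: Lp_fun_def)
qed (simp add: powr_mult)

lemma Lp_fun_zero: "(\<lambda>_. 0) \<in> Lp_fun M p"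
  by (auto simp: Lp_fun_def strongly_measurable_def simple_bochner_integrable.simps
      intro!: exI[of _ "\<lambda>_ _. 0"])

lemma rep_Lp_class:
  assumes "f \<in> Lp_fun M p"
  shows "rep (Lp_class M p f) \<in> Lp_fun M p" "AE s in M. rep (Lp_class M p f) s = f s"
proof -
  have "rep (Lp_class M p f) \<in> Lp_class M p f"
    unfolding rep_def by (rule someI[of _ f]) (use assms in \<open>simp add: Lp_class_def\<close>)
  then show "rep (Lp_class M p f) \<in> Lp_fun M p" "AE s in M. rep (Lp_class M p f) s = f s"
    by (auto simp: Lp_class_def)
qed

lemma Lp_class_cong:
  assumes "AE s in M. f s = g s"
  shows "Lp_class M p f = Lp_class M p g"
proof -
  have "(AE s in M. h s = f s) \<longleftrightarrow> (AE s in M. h s = g s)" for h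
    by (intro eventually_subst) (use assms in \<open>eventually_elim, simp\<close>)
  then show ?thesis by (simp add: Lp_class_def)
qed

lemma Lp_class_rep:
  assumes "F \<in> Lp M p"
  shows "Lp_class M p (rep F) = F"
proof -
  obtain f where f: "f \<in> Lp_fun M p" "F = Lp_class M p f" using assms by (auto simp: Lp_def)
  show ?thesis unfolding f(2) by (rule Lp_class_cong[OF rep_Lp_class(2)[OF f(1)]])
qed

lemma rep_Lp_fun: "F \<in> Lp M p \<Longrightarrow> rep F \<in> Lp_fun M p"
  by (auto simp: Lp_def rep_Lp_class)

lemma Lp_class_in_Lp: "f \<in> Lp_fun M p \<Longrightarrow> Lp_class M p f \<in> Lp M p"
  by (simp add: Lp_def)

lemma Lp_eqI:
  assumes "F \<in> Lp M p" "G \<in> Lp M p" "AE s in M. rep F s = rep G s"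
  shows "F = G"
  using Lp_class_cong[OF assms(3), of p] assms(1,2) by (simp add: Lp_class_rep)


lemma Lp_norm_nonneg: "Lp_norm M p F \<ge> 0"
  by (simp add: Lp_norm_def)

lemma Lp_norm_powr:
  assumes "p > 0"
  shows "Lp_norm M p F powr p = (\<integral>s. norm (rep F s) powr p \<partial>M)"
  using assms by (simp add: Lp_norm_def powr_powr integral_nonneg_AE)

lemma integrable_rep: "F \<in> Lp M p \<Longrightarrow> integrable M (\<lambda>s. norm (rep F s) powr p)"
  using rep_Lp_fun[of F M p] by (simp add: Lp_fun_def)

lemma Lp_norm_class:
  assumes "f \<in> Lp_fun M p"
  shows "Lp_norm M p (Lp_class M p f) = (\<integral>s. norm (f s) powr p \<partial>M) powr (1 / p)"
proof -
  have "(\<integral>s. norm (rep (Lp_class M p f) s) powr p \<partial>M) = (\<integral>s. norm (f s) powr p \<partial>M)"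
    by (rule integral_cong_AE)
      (use rep_Lp_class[OF assms] assms in \<open>auto simp: Lp_fun_def\<close>)
  then show ?thesis by (simp add: Lp_norm_def)
qed

lemma Lp_norm_eq_0_iff:
  assumes "p > 0" "F \<in> Lp M p"
  shows "Lp_norm M p F = 0 \<longleftrightarrow> (AE s in M. rep F s = 0)"
  using integral_nonneg_eq_0_iff_AE[OF integrable_rep[OF assms(2)]] by (simp add: Lp_norm_def)

context
  fixes M :: "'s measure" and p :: real
  assumes M: "complete_measure M" and p: "p > 0"
begin

lemma
  fixes F :: "('s \<Rightarrow> 'a::real_normed_vector) set"
  assumes F: "F \<in> Lp M p"
  shows Lp_scale_in_Lp: "Lp_scale M p c F \<in> Lp M p"
    and rep_Lp_scale: "AE s in M. rep (Lp_scale M p c F) s = c *\<^sub>R rep F s"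
    and Lp_norm_scale: "Lp_norm M p (Lp_scale M p c F) = \<bar>c\<bar> * Lp_norm M p F"
proof -
  have *: "(\<lambda>s. c *\<^sub>R rep F s) \<in> Lp_fun M p" by (rule Lp_fun_scale[OF M p rep_Lp_fun[OF F]])
  show "Lp_scale M p c F \<in> Lp M p" "AE s in M. rep (Lp_scale M p c F) s = c *\<^sub>R rep F s"
    unfolding Lp_scale_def using * by (simp_all add: Lp_class_in_Lp rep_Lp_class)
  have "Lp_norm M p (Lp_scale M p c F) = (\<integral>s. norm (c *\<^sub>R rep F s) powr p \<partial>M) powr (1 / p)"
    unfolding Lp_scale_def by (rule Lp_norm_class[OF *])
  also have "\<dots> = \<bar>c\<bar> * Lp_norm M p F"
    using p by (simp add: Lp_norm_def powr_mult powr_powr)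
  finally show "Lp_norm M p (Lp_scale M p c F) = \<bar>c\<bar> * Lp_norm M p F" .
qed

lemma
  fixes F G :: "('s \<Rightarrow> 'a::real_normed_vector) set"
  assumes F: "F \<in> Lp M p" and G: "G \<in> Lp M p"
  shows Lp_diff_in_Lp: "Lp_diff M p F G \<in> Lp M p"
    and rep_Lp_diff: "AE s in M. rep (Lp_diff M p F G) s = rep F s - rep G s"
  unfolding Lp_diff_def using Lp_fun_diff[OF M p rep_Lp_fun[OF F] rep_Lp_fun[OF G]]
  by (simp_all add: Lp_class_in_Lp rep_Lp_class)

lemma Lp_norm_diff_eq_0_iff:
  fixes F G :: "('s \<Rightarrow> 'a::real_normed_vector) set"
  assumes F: "F \<in> Lp M p" and G: "G \<in> Lp M p"
  shows "Lp_norm M p (Lp_diff M p F G) = 0 \<longleftrightarrow> F = G"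
proof -
  have "Lp_norm M p (Lp_diff M p F G) = 0 \<longleftrightarrow> (AE s in M. rep (Lp_diff M p F G) s = 0)"
    by (rule Lp_norm_eq_0_iff[OF p Lp_diff_in_Lp[OF F G]])
  also have "\<dots> \<longleftrightarrow> (AE s in M. rep F s = rep G s)"
    by (intro eventually_subst) (use rep_Lp_diff[OF F G] in \<open>eventually_elim, simp\<close>)
  also have "\<dots> \<longleftrightarrow> F = G" using Lp_eqI[OF F G] by auto
  finally show ?thesis .
qed

lemma Lp_zero_in_Lp: "(Lp_zero M p :: ('s \<Rightarrow> 'a::real_normed_vector) set) \<in> Lp M p"
  by (simp add: Lp_zero_def Lp_class_in_Lp Lp_fun_zero)

lemma Lp_diff_zero:
  fixes F :: "('s \<Rightarrow> 'a::real_normed_vector) set"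
  assumes F: "F \<in> Lp M p"
  shows "Lp_diff M p F (Lp_zero M p) = F"
proof (rule Lp_eqI[OF Lp_diff_in_Lp[OF F Lp_zero_in_Lp] F])
  show "AE s in M. rep (Lp_diff M p F (Lp_zero M p)) s = rep F s"
    using rep_Lp_diff[OF F Lp_zero_in_Lp] rep_Lp_class(2)[OF Lp_fun_zero[of M p]]
    unfolding Lp_zero_def by eventually_elim simp
qed

lemma Lp_cball_eq: "Lp_cball M p r = {F \<in> Lp M p. Lp_norm M p F \<le> r}"
  by (auto simp: Lp_cball_def Lp_diff_zero)

lemma Lp_norm_diff_scale:
  fixes F :: "('s \<Rightarrow> 'a::real_normed_vector) set"
  assumes F: "F \<in> Lp M p"
  shows "Lp_norm M p (Lp_diff M p F (Lp_scale M p c F)) = \<bar>1 - c\<bar> * Lp_norm M p F"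
proof -
  have "Lp_diff M p F (Lp_scale M p c F) = Lp_scale M p (1 - c) F"
    unfolding Lp_diff_def Lp_scale_def[of M p "1 - c"]
    by (rule Lp_class_cong) (use rep_Lp_scale[OF F, of c] in \<open>eventually_elim, simp add: algebra_simps\<close>)
  then show ?thesis by (simp add: Lp_norm_scale[OF F])
qed

end

section \<open>Hoelder's inequality and its equality case\<close>

text \<open>
  Dividing Young's inequality by \<open>a b\<close> turns it into a combination of the two inequalities
  \<open>ln A \<le> A - 1\<close> and \<open>ln B \<le> B - 1\<close> in which the logarithms cancel, so equality forces
  \<open>A = B = 1\<close>.
\<close>

lemma Youngs_equality:
  fixes a b p q :: real
  assumes pq: "1 < p" "1 < q" "1 / p + 1 / q = 1" and ab: "a \<ge> 0" "b \<ge> 0"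
    and eq: "a * b = a powr p / p + b powr q / q"
  shows "a powr p = b powr q"
proof (cases "a = 0 \<or> b = 0")
  case True
  then show ?thesis using eq pq by auto
next
  case False
  then have pos: "a > 0" "b > 0" using ab by auto
  define A where "A = a powr p / (a * b)"
  define B where "B = b powr q / (a * b)"
  have AB: "A > 0" "B > 0" using pos by (simp_all add: A_def B_def)
  have "ln A / p = ln a - (ln a + ln b) * (1 / p)" "ln B / q = ln b - (ln a + ln b) * (1 / q)"
    using pos pq by (simp_all add: A_def B_def ln_div ln_mult ln_powr diff_divide_distrib)
  then have "ln A / p + ln B / q = (ln a + ln b) * (1 - (1 / p + 1 / q))"
    by (simp only: right_diff_distrib distrib_left) simp
  then have lns: "ln A / p + ln B / q = 0" using pq by simp
  have "A / p + B / q = (a powr p / p + b powr q / q) / (a * b)"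
    by (simp add: A_def B_def add_divide_distrib mult.commute)
  also have "\<dots> = 1" using eq[symmetric] pos by simp
  finally have sum: "(A - 1) / p + (B - 1) / q = 0"
    using pq(3) by (simp add: diff_divide_distrib)
  have le: "ln A / p \<le> (A - 1) / p" "ln B / q \<le> (B - 1) / q"
    using ln_le_minus_one AB pq by (auto intro!: divide_right_mono)
  have "ln A / p = (A - 1) / p" "ln B / q = (B - 1) / q" using le lns sum by linarith+
  then have "A = 1" "B = 1" using ln_eq_minus_one AB pq by auto
  then show ?thesis using pos by (simp add: A_def B_def)
qed

definition Lp_pair :: "('a \<Rightarrow> 'b \<Rightarrow> real) \<Rightarrow> 's measure \<Rightarrow> ('s \<Rightarrow> 'a) set \<Rightarrow> ('s \<Rightarrow> 'b) set \<Rightarrow> real" where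
  "Lp_pair B M F G = (\<integral>s. B (rep F s) (rep G s) \<partial>M)"

context
  fixes M :: "'s measure" and p q :: real
    and B :: "'a::real_normed_vector \<Rightarrow> 'b::real_normed_vector \<Rightarrow> real" and u :: "'a \<Rightarrow> 'b"
  assumes M: "complete_measure M" and p: "1 < p" and q: "1 < q" and pq: "1 / p + 1 / q = 1"
    and u: "norming_map B u"
begin

interpretation bounded_bilinear B by (rule norming_mapD[OF u])

lemma integrable_pair_fun:
  assumes f: "f \<in> Lp_fun M p" and g: "g \<in> Lp_fun M q"
  shows "integrable M (\<lambda>s. B (f s) (g s))"
proof (rule Bochner_Integration.integrable_bound)
  show "integrable M (\<lambda>s. norm (f s) powr p / p + norm (g s) powr q / q)"
    using f g by (simp add: Lp_fun_def)
  have "strongly_measurable M (\<lambda>s. B (f s) (g s))"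
    by (rule strongly_measurable_compose2[where h = B])
      (use f g in \<open>auto simp: Lp_fun_def zero_left intro!: continuous_on continuous_intros\<close>)
  then show "(\<lambda>s. B (f s) (g s)) \<in> borel_measurable M"
    by (rule complete_measure.borel_measurable_if_strongly_measurable[OF M])
  show "AE s in M. norm (B (f s) (g s)) \<le> norm (norm (f s) powr p / p + norm (g s) powr q / q)"
  proof (rule AE_I2)
    fix s
    have "\<bar>B (f s) (g s)\<bar> \<le> norm (f s) * norm (g s)" by (rule norming_mapD[OF u])
    also have "\<dots> \<le> norm (f s) powr p / p + norm (g s) powr q / q"
      using p q pq by (intro Youngs_inequality) auto
    finally show "norm (B (f s) (g s)) \<le> norm (norm (f s) powr p / p + norm (g s) powr q / q)" by simp
  qed
qed

lemma integrable_pair: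
  assumes "F \<in> Lp M p" "G \<in> Lp M q"
  shows "integrable M (\<lambda>s. B (rep F s) (rep G s))"
  by (rule integrable_pair_fun) (use assms rep_Lp_fun in blast)+

text \<open>
  The integrand \<open>D\<close> is the pointwise defect in Young's inequality for the normalized functions. Its
  integral is the defect in Hoelder's inequality, which is therefore nonnegative and vanishes only if
  \<open>D\<close> vanishes almost everywhere.
\<close>

lemma Hoelder_defect:
  assumes F: "F \<in> Lp M p" and G: "G \<in> Lp M q" and pos: "Lp_norm M p F > 0" "Lp_norm M q G > 0"
  defines "D \<equiv> \<lambda>s. (norm (rep F s) / Lp_norm M p F) powr p / p + (norm (rep G s) / Lp_norm M q G) powr q / q
      - B (rep F s) (rep G s) / (Lp_norm M p F * Lp_norm M q G)"
  shows "integrable M D" "(\<integral>s. D s \<partial>M) = 1 - Lp_pair B M F G / (Lp_norm M p F * Lp_norm M q G)"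
    and "D s \<ge> 0" 
    and "D s = 0 \<Longrightarrow> B (rep F s) (rep G s) = norm (rep F s) * norm (rep G s) \<and>
         (norm (rep F s) / Lp_norm M p F) powr p = (norm (rep G s) / Lp_norm M q G) powr q"
proof -
  note int = integrable_rep[OF F] integrable_rep[OF G] integrable_pair[OF F G]
  show "integrable M D" unfolding D_def powr_divide using int by simp
  have "(\<integral>s. D s \<partial>M) = (\<integral>s. norm (rep F s) powr p \<partial>M) / Lp_norm M p F powr p / p
      + (\<integral>s. norm (rep G s) powr q \<partial>M) / Lp_norm M q G powr q / q
      - Lp_pair B M F G / (Lp_norm M p F * Lp_norm M q G)"
    unfolding D_def powr_divide Lp_pair_def using int by simp
  also have "\<dots> = 1 / p + 1 / q - Lp_pair B M F G / (Lp_norm M p F * Lp_norm M q G)"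
    using p q pos by (simp flip: Lp_norm_powr)
  finally show "(\<integral>s. D s \<partial>M) = 1 - Lp_pair B M F G / (Lp_norm M p F * Lp_norm M q G)"
    using pq by simp
  define a b where "a = norm (rep F s) / Lp_norm M p F" and "b = norm (rep G s) / Lp_norm M q G"
  have ab: "a \<ge> 0" "b \<ge> 0" using pos by (simp_all add: a_def b_def)
  have D: "D s = a powr p / p + b powr q / q - B (rep F s) (rep G s) / (Lp_norm M p F * Lp_norm M q G)"
    by (simp add: D_def a_def b_def)
  have le1: "B (rep F s) (rep G s) / (Lp_norm M p F * Lp_norm M q G) \<le> a * b"
    using norming_mapD(2)[OF u, of "rep F s" "rep G s"] pos
    by (simp add: a_def b_def divide_right_mono)
  have le2: "a * b \<le> a powr p / p + b powr q / q"
    using p q pq ab by (intro Youngs_inequality)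
  show "D s \<ge> 0" using D le1 le2 by linarith
  assume "D s = 0"
  then have eqs: "a * b = a powr p / p + b powr q / q"
    "B (rep F s) (rep G s) / (Lp_norm M p F * Lp_norm M q G) = a * b" using D le1 le2 by linarith+
  from eqs(2) have "B (rep F s) (rep G s) = norm (rep F s) * norm (rep G s)"
    using pos by (simp add: a_def b_def)
  moreover have "a powr p = b powr q" by (rule Youngs_equality[OF p q pq ab eqs(1)])
  ultimately show "B (rep F s) (rep G s) = norm (rep F s) * norm (rep G s) \<and>
         (norm (rep F s) / Lp_norm M p F) powr p = (norm (rep G s) / Lp_norm M q G) powr q"
    by (simp add: a_def b_def)
qed

lemma Hoelder:
  assumes F: "F \<in> Lp M p" and G: "G \<in> Lp M q"
  shows "Lp_pair B M F G \<le> Lp_norm M p F * Lp_norm M q G"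
proof (cases "Lp_norm M p F = 0 \<or> Lp_norm M q G = 0")
  case True
  then have "(AE s in M. rep F s = 0) \<or> (AE s in M. rep G s = 0)"
    using Lp_norm_eq_0_iff F G p q by (metis less_trans zero_less_one)
  then have "AE s in M. B (rep F s) (rep G s) = 0"
    by (auto elim!: eventually_mono simp: zero_left zero_right)
  then have "Lp_pair B M F G = 0" unfolding Lp_pair_def by (rule integral_eq_zero_AE)
  then show ?thesis by (simp add: Lp_norm_nonneg)
next
  case False
  then have pos: "Lp_norm M p F > 0" "Lp_norm M q G > 0" using Lp_norm_nonneg by (metis less_le)+
  have "0 \<le> 1 - Lp_pair B M F G / (Lp_norm M p F * Lp_norm M q G)"
    unfolding Hoelder_defect(2)[OF F G pos, symmetric]
    by (rule integral_nonneg_AE) (rule AE_I2, rule Hoelder_defect(3)[OF F G pos])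
  then show ?thesis using pos by (simp add: field_simps)
qed

lemma Hoelder_equality:
  assumes F: "F \<in> Lp M p" and G: "G \<in> Lp M q" and pos: "Lp_norm M p F > 0" "Lp_norm M q G > 0"
    and eq: "Lp_pair B M F G = Lp_norm M p F * Lp_norm M q G"
  shows "AE s in M. B (rep F s) (rep G s) = norm (rep F s) * norm (rep G s) \<and>
         (norm (rep F s) / Lp_norm M p F) powr p = (norm (rep G s) / Lp_norm M q G) powr q"
proof -
  have "AE s in M. (norm (rep F s) / Lp_norm M p F) powr p / p + (norm (rep G s) / Lp_norm M q G) powr q / q
      - B (rep F s) (rep G s) / (Lp_norm M p F * Lp_norm M q G) = 0"
    by (subst integral_nonneg_eq_0_iff_AE[symmetric, OF Hoelder_defect(1)[OF F G pos]])
      (use Hoelder_defect(2,3)[OF F G pos] eq pos in auto)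
  then show ?thesis by eventually_elim (rule Hoelder_defect(4)[OF F G pos])
qed

text \<open>
  Equality in Hoelder's inequality fixes the norm of \<open>rep G s\<close> in terms of that of \<open>rep F s\<close> and
  makes \<open>rep G s\<close> a norming vector of \<open>rep F s\<close>, which leaves a single value at almost every \<open>s\<close>.
  The second assumption on the norms is there because every \<open>G\<close> attains equality with a zero \<open>F\<close>.
\<close>

lemma norming_element_unique:
  assumes F: "F \<in> Lp M p" and G: "G \<in> Lp M q" "G' \<in> Lp M q"
    and norms: "Lp_norm M q G = Lp_norm M q G'" "Lp_norm M p F = 0 \<Longrightarrow> Lp_norm M q G = 0"
    and eq: "Lp_pair B M F G = Lp_norm M p F * Lp_norm M q G"
      "Lp_pair B M F G' = Lp_norm M p F * Lp_norm M q G'"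
  shows "G = G'"
proof (rule Lp_eqI[OF G])
  show "AE s in M. rep G s = rep G' s"
  proof (cases "Lp_norm M q G = 0")
    case True
    then have "AE s in M. rep G s = 0" "AE s in M. rep G' s = 0"
      using Lp_norm_eq_0_iff[of q] G q norms(1) by auto
    then show ?thesis by eventually_elim simp
  next
    case False
    then have pos: "Lp_norm M p F > 0" "Lp_norm M q G > 0" "Lp_norm M q G' > 0"
      using Lp_norm_nonneg norms by (metis less_le)+
    show ?thesis
      using Hoelder_equality[OF F G(1) pos(1,2) eq(1)] Hoelder_equality[OF F G(2) pos(1,3) eq(2)]
    proof eventually_elim
      case (elim s)
      have root: "(norm z powr q) powr (1 / q) = norm z" for z :: 'b
        using q by (simp add: powr_powr)
      from elim have "norm (rep G s) powr q = norm (rep G' s) powr q"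
        using pos norms by (simp add: powr_divide)
      then have same: "norm (rep G s) = norm (rep G' s)"
        by (metis root)
      show ?case
      proof (cases "rep F s = 0")
        case True
        then have "norm (rep G s) = 0" using elim pos by simp
        with same show ?thesis by simp
      next
        case False
        then show ?thesis using norming_map_unique[OF u False] elim same by metis
      qed
    qed
  qed
qed

section \<open>The duality mappings of Bochner spaces\<close>

text \<open>
  The explicit formula is \<open>G s = \<parallel>F\<parallel>\<^sup>2\<^sup>-\<^sup>p \<parallel>F s\<parallel>\<^sup>p\<^sup>-\<^sup>1 u (F s / \<parallel>F s\<parallel>)\<close>. The power \<open>p - 1\<close> is dictated by the
  equality case of Hoelder's inequality, and the factor in front adjusts the norm. As \<open>0\<close> to any real
  power is \<open>0\<close>, the formula also covers a zero \<open>F\<close> and the zeros of \<open>F\<close>.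
\<close>

lemma norming_element_exists:
  assumes F: "F \<in> Lp M p"
  shows "\<exists>G\<in>Lp M q. Lp_norm M q G = Lp_norm M p F \<and> Lp_pair B M F G = (Lp_norm M p F)\<^sup>2"
proof -
  define N where "N = Lp_norm M p F"
  define f where "f = rep F"
  define h where "h x = norm x powr (p - 1) *\<^sub>R u (sgn x)" for x
  define c where "c = N powr (2 - p)"
  define k where "k s = c *\<^sub>R h (f s)" for s
  have "p - 1 > 0" using p by simp
  note h = norming_map_homogeneous[OF u this, folded h_def]
  have f: "f \<in> Lp_fun M p" unfolding f_def by (rule rep_Lp_fun[OF F])
  have N: "N \<ge> 0" "N powr p = (\<integral>s. norm (f s) powr p \<partial>M)"
    using Lp_norm_nonneg Lp_norm_powr[of p M F] p by (auto simp: N_def f_def)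
  have "c \<ge> 0" by (simp add: c_def)
  have conj: "(p - 1) * q = p" "p / q = p - 1" using p q pq by (simp_all add: field_simps)
  have nk: "norm (k s) powr q = c powr q * norm (f s) powr p" for s
    using \<open>c \<ge> 0\<close> h(1) conj by (simp add: k_def powr_mult powr_powr)
  have k: "k \<in> Lp_fun M q"
  proof (rule Lp_funI[OF M])
    show "strongly_measurable M k" unfolding k_def
      by (rule strongly_measurable_compose[where h = "\<lambda>x. c *\<^sub>R h x"])
        (use f h(3) in \<open>auto simp: Lp_fun_def h_def[of 0] intro!: continuous_intros\<close>)
    show "integrable M (\<lambda>s. c powr q * norm (f s) powr p)"
      using f by (simp add: Lp_fun_def)
  qed (use q nk in auto)
  define G where "G = Lp_class M q k"
  have G: "G \<in> Lp M q" unfolding G_def by (rule Lp_class_in_Lp[OF k])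
  have "Lp_norm M q G = (c powr q * N powr p) powr (1 / q)"
    unfolding G_def Lp_norm_class[OF k] nk N by simp
  also have "\<dots> = c * N powr (p - 1)"
    using q conj \<open>c \<ge> 0\<close> by (simp add: powr_mult powr_powr)
  also have "\<dots> = N" using N(1) by (simp add: c_def flip: powr_add)
  finally have 1: "Lp_norm M q G = N" .
  have "Lp_pair B M F G = (\<integral>s. B (f s) (k s) \<partial>M)"
    unfolding Lp_pair_def f_def[symmetric]
  proof (rule integral_cong_AE)
    show "AE s in M. B (f s) (rep G s) = B (f s) (k s)"
      using rep_Lp_class(2)[OF k] unfolding G_def by eventually_elim simp
  qed (use integrable_pair[OF F G] integrable_pair_fun[OF f k] in \<open>auto simp: f_def\<close>)
  also have "\<dots> = (\<integral>s. c * norm (f s) powr p \<partial>M)"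
    by (simp add: k_def scaleR_right h(2))
  also have "\<dots> = c * N powr p" by (simp add: N)
  also have "\<dots> = N\<^sup>2" using N(1) by (simp add: c_def flip: powr_add)
  finally show ?thesis using G 1 by (auto simp: N_def)
qed

lemma duality_map_eqI:
  assumes F: "F \<in> Lp M p" and G: "G \<in> Lp M q"
    and "Lp_norm M q G = Lp_norm M p F" "Lp_pair B M F G = (Lp_norm M p F)\<^sup>2"
  shows "duality_map (Lp M q) (Lp_norm M q) (Lp_norm M p) (\<lambda>G F. Lp_pair B M F G) F = G"
  unfolding duality_map_def
proof (rule the_equality)
  fix H assume H: "H \<in> Lp M q \<and> Lp_pair B M F H = Lp_norm M q H * Lp_norm M p F \<and>
    Lp_norm M q H * Lp_norm M p F = (Lp_norm M p F)\<^sup>2 \<and> (Lp_norm M p F)\<^sup>2 = (Lp_norm M q H)\<^sup>2"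
  then have "Lp_norm M q H = Lp_norm M p F"
    by (metis Lp_norm_nonneg power2_eq_iff_nonneg)
  then show "H = G"
    using H assms by (intro norming_element_unique[OF F]) (auto simp: power2_eq_square)
qed (use assms in \<open>auto simp: power2_eq_square\<close>)

lemma duality_map_props:
  assumes F: "F \<in> Lp M p"
  defines "G \<equiv> duality_map (Lp M q) (Lp_norm M q) (Lp_norm M p) (\<lambda>G F. Lp_pair B M F G) F"
  shows "G \<in> Lp M q" "Lp_norm M q G = Lp_norm M p F" "Lp_pair B M F G = (Lp_norm M p F)\<^sup>2"
  using norming_element_exists[OF F] duality_map_eqI[OF F] unfolding G_def by metis+

end

section \<open>Projections onto balls\<close>

context
  fixes M :: "'s measure" and p q :: real
    and u :: "('x::real_normed_vector \<Rightarrow>\<^sub>L real) \<Rightarrow> 'x" and v :: "'x \<Rightarrow> ('x \<Rightarrow>\<^sub>L real)"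
  assumes M: "complete_measure M" and p: "1 < p" and q: "1 < q" and pq: "1 / p + 1 / q = 1"
    and u: "norming_map (blinfun_apply :: ('x \<Rightarrow>\<^sub>L real) \<Rightarrow> 'x \<Rightarrow> real) u"
    and v: "norming_map (\<lambda>(x::'x) (f :: 'x \<Rightarrow>\<^sub>L real). blinfun_apply f x) v"
begin

lemma qp: "1 / q + 1 / p = 1" using pq by simp

lemma pairing_eq:
  fixes F :: "('s \<Rightarrow> 'x) set"
  shows "pairing M \<Phi> F = Lp_pair blinfun_apply M \<Phi> F"
    "pairing M \<Phi> F = Lp_pair (\<lambda>x f. blinfun_apply f x) M F \<Phi>"
  by (simp_all add: pairing_def Lp_pair_def)

lemmas pairing_le = Hoelder[OF M q p qp u, folded pairing_eq(1)]

lemmas pairing_unique = norming_element_unique[OF M q p qp u, folded pairing_eq(1)]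

lemma Jp_props:
  fixes F :: "('s \<Rightarrow> 'x) set"
  assumes "F \<in> Lp M p"
  shows "Jp M p q F \<in> Lp M q" "Lp_norm M q (Jp M p q F) = Lp_norm M p F"
    "pairing M (Jp M p q F) F = (Lp_norm M p F)\<^sup>2"
  using duality_map_props[OF M p q pq v assms] by (simp_all add: Jp_def flip: pairing_eq(2))

lemma Jq_star_props:
  fixes \<Phi> :: "('s \<Rightarrow> 'x \<Rightarrow>\<^sub>L real) set"
  assumes "\<Phi> \<in> Lp M q"
  shows "Jq_star M p q \<Phi> \<in> Lp M p" "Lp_norm M p (Jq_star M p q \<Phi>) = Lp_norm M q \<Phi>"
    "pairing M \<Phi> (Jq_star M p q \<Phi>) = (Lp_norm M q \<Phi>)\<^sup>2"
  using duality_map_props[OF M q p qp u assms] by (simp_all add: Jq_star_def flip: pairing_eq(1))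

lemma Jq_star_Jp:
  fixes F :: "('s \<Rightarrow> 'x) set"
  assumes "F \<in> Lp M p"
  shows "Jq_star M p q (Jp M p q F) = F"
  using duality_map_eqI[OF M q p qp u Jp_props(1)[OF assms] assms] Jp_props[OF assms]
  by (simp add: Jq_star_def flip: pairing_eq(1))

lemma pairing_scale:
  fixes F :: "('s \<Rightarrow> 'x) set"
  assumes \<Phi>: "\<Phi> \<in> Lp M q" and F: "F \<in> Lp M p"
  shows "pairing M \<Phi> (Lp_scale M p c F) = c * pairing M \<Phi> F"
proof -
  have p0: "p > 0" using p by simp
  have "pairing M \<Phi> (Lp_scale M p c F) = (\<integral>s. c * blinfun_apply (rep \<Phi> s) (rep F s) \<partial>M)"
    unfolding pairing_def
  proof (rule integral_cong_AE)
    show "AE s in M. blinfun_apply (rep \<Phi> s) (rep (Lp_scale M p c F) s) = c * blinfun_apply (rep \<Phi> s) (rep F s)"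
      using rep_Lp_scale[OF M p0 F, of c] by eventually_elim (simp add: blinfun.scaleR_right)
  qed (use integrable_pair[OF M q p qp u \<Phi>] F Lp_scale_in_Lp[OF M p0 F] in auto)
  then show ?thesis by (simp add: pairing_def)
qed

lemma pairing_diff:
  fixes F :: "('s \<Rightarrow> 'x) set"
  assumes \<Phi>: "\<Phi> \<in> Lp M q" and F: "F \<in> Lp M p" and G: "G \<in> Lp M p"
  shows "pairing M \<Phi> (Lp_diff M p F G) = pairing M \<Phi> F - pairing M \<Phi> G"
proof -
  have p0: "p > 0" using p by simp
  note int = integrable_pair[OF M q p qp u \<Phi>]
  have "pairing M \<Phi> (Lp_diff M p F G) =
      (\<integral>s. blinfun_apply (rep \<Phi> s) (rep F s) - blinfun_apply (rep \<Phi> s) (rep G s) \<partial>M)"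
    unfolding pairing_def
  proof (rule integral_cong_AE)
    show "AE s in M. blinfun_apply (rep \<Phi> s) (rep (Lp_diff M p F G) s)
        = blinfun_apply (rep \<Phi> s) (rep F s) - blinfun_apply (rep \<Phi> s) (rep G s)"
      using rep_Lp_diff[OF M p0 F G] by eventually_elim (simp add: blinfun.diff_right)
  qed (use int F G Lp_diff_in_Lp[OF M p0 F G] in auto)
  then show ?thesis using int[OF F] int[OF G] by (simp add: pairing_def)
qed

text \<open>
  The bound \<open>V(\<Phi>, f) \<ge> (\<parallel>\<Phi>\<parallel> - \<parallel>f\<parallel>)\<^sup>2 \<ge> (\<parallel>\<Phi>\<parallel> - min \<parallel>\<Phi>\<parallel> r)\<^sup>2\<close> is sharp exactly at norming elements of
  norm \<open>min \<parallel>\<Phi>\<parallel> r\<close>.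
\<close>

lemma gen_proj_cball_eqI:
  fixes \<Phi> :: "('s \<Rightarrow> 'x \<Rightarrow>\<^sub>L real) set"
  assumes \<Phi>: "\<Phi> \<in> Lp M q" and h: "h \<in> Lp M p" "Lp_norm M p h = min (Lp_norm M q \<Phi>) r"
    and eq: "pairing M \<Phi> h = Lp_norm M q \<Phi> * Lp_norm M p h"
  shows "gen_proj M p q (Lp_cball M p r) \<Phi> = h"
proof -
  have p0: "p > 0" using p by simp
  let ?N = "Lp_norm M q \<Phi>" and ?V = "lyapunov_V M p q \<Phi>" and ?C = "Lp_cball M p r :: ('s \<Rightarrow> 'x) set set"
  note C = Lp_cball_eq[OF M p0, of r, where 'a = 'x]
  have hC: "h \<in> ?C" using h by (simp add: C)
  have Vh: "?V h = (?N - min ?N r)\<^sup>2"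
    unfolding lyapunov_V_def eq h(2) by (simp add: power2_diff)
  have low: "(?N - Lp_norm M p f)\<^sup>2 \<le> ?V f" if "f \<in> ?C" for f
    using pairing_le[OF \<Phi>, of f] that by (simp add: C lyapunov_V_def power2_diff)
  have gap: "0 \<le> ?N - min ?N r" by simp
  have gap_le: "?N - min ?N r \<le> \<bar>?N - Lp_norm M p f\<bar>" if "f \<in> ?C" for f
    using that by (auto simp: C min_def)
  have low': "(?N - min ?N r)\<^sup>2 \<le> (?N - Lp_norm M p f)\<^sup>2" if "f \<in> ?C" for f
    using power_mono[OF gap_le[OF that] gap, of 2] by simp
  have "?V h \<le> ?V f" if "f \<in> ?C" for f using low[OF that] low'[OF that] Vh by linarith
  then have min: "(INF f\<in>?C. ?V f) = ?V h"
    by (intro cInf_eq_minimum) (use hC in auto)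
  show ?thesis unfolding gen_proj_def min
  proof (rule the_equality)
    fix f assume "f \<in> ?C \<and> ?V f = ?V h"
    then have f: "f \<in> Lp M p" "Lp_norm M p f \<le> r" "f \<in> ?C" and Vf: "?V f = (?N - min ?N r)\<^sup>2" by (auto simp: C Vh)
    have sq: "(?N - Lp_norm M p f)\<^sup>2 = (?N - min ?N r)\<^sup>2" using low[OF f(3)] low'[OF f(3)] Vf by simp
    then have norm: "Lp_norm M p f = min ?N r"
      using f(2) by (auto simp: power2_eq_iff min_def split: if_splits)
    have "pairing M \<Phi> f = ?N * Lp_norm M p f"
      using Vf sq by (simp add: lyapunov_V_def power2_diff)
    then show "f = h" using eq h norm Lp_norm_nonneg[of M p h]
      by (intro pairing_unique[OF \<Phi> f(1) h(1)]) auto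
  qed (use hC in simp)
qed

lemma gen_proj_cball:
  fixes \<Phi> :: "('s \<Rightarrow> 'x \<Rightarrow>\<^sub>L real) set"
  assumes \<Phi>: "\<Phi> \<in> Lp M q" and "r > 0"
  shows "Lp_norm M q \<Phi> \<le> r \<Longrightarrow> gen_proj M p q (Lp_cball M p r) \<Phi> = Jq_star M p q \<Phi>"
    and "Lp_norm M q \<Phi> > r \<Longrightarrow>
      gen_proj M p q (Lp_cball M p r) \<Phi> = Lp_scale M p (r / Lp_norm M q \<Phi>) (Jq_star M p q \<Phi>)"
proof -
  have p0: "p > 0" using p by simp
  note J = Jq_star_props[OF \<Phi>]
  show "gen_proj M p q (Lp_cball M p r) \<Phi> = Jq_star M p q \<Phi>" if "Lp_norm M q \<Phi> \<le> r"
    using J that by (intro gen_proj_cball_eqI[OF \<Phi>]) (auto simp: power2_eq_square)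
  show "gen_proj M p q (Lp_cball M p r) \<Phi> = Lp_scale M p (r / Lp_norm M q \<Phi>) (Jq_star M p q \<Phi>)"
    if "Lp_norm M q \<Phi> > r"
    using J that \<open>r > 0\<close>
    by (intro gen_proj_cball_eqI[OF \<Phi>])
      (auto simp: power2_eq_square Lp_scale_in_Lp[OF M p0] Lp_norm_scale[OF M p0] pairing_scale[OF \<Phi>])
qed

lemma gen_metric_proj_cball:
  fixes g :: "('s \<Rightarrow> 'x) set"
  assumes g: "g \<in> Lp M p" and "r > 0"
  shows "Lp_norm M p g \<le> r \<Longrightarrow> gen_metric_proj M p q (Lp_cball M p r) g = g"
    and "Lp_norm M p g > r \<Longrightarrow>
      gen_metric_proj M p q (Lp_cball M p r) g = Lp_scale M p (r / Lp_norm M p g) g"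
  using gen_proj_cball[OF Jp_props(1)[OF g] \<open>r > 0\<close>]
  by (simp_all add: gen_metric_proj_def Jp_props(2)[OF g] Jq_star_Jp[OF g])

lemma metric_proj_cball_inside:
  fixes g :: "('s \<Rightarrow> 'x) set"
  assumes g: "g \<in> Lp_cball M p r"
  shows "metric_proj M p (Lp_cball M p r) g = g"
proof -
  have p0: "p > 0" using p by simp
  note C = Lp_cball_eq[OF M p0, of r, where 'a = 'x]
  have gL: "g \<in> Lp M p" using g by (simp add: C)
  have dist0: "Lp_norm M p (Lp_diff M p g h) = 0 \<longleftrightarrow> g = h" if "h \<in> Lp_cball M p r" for h
    using Lp_norm_diff_eq_0_iff[OF M p0 gL] that by (simp add: C)
  show ?thesis unfolding metric_proj_def
  proof (rule the_equality)
    fix h assume h: "h \<in> Lp_cball M p r \<and>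
      (\<forall>z\<in>Lp_cball M p r. Lp_norm M p (Lp_diff M p g h) \<le> Lp_norm M p (Lp_diff M p g z))"
    then have "Lp_norm M p (Lp_diff M p g h) \<le> 0" using g dist0[OF g] by force
    then show "h = g" using dist0[of h] h Lp_norm_nonneg[of M p "Lp_diff M p g h"] by auto
  qed (use g dist0[OF g] Lp_norm_nonneg in auto)
qed

text \<open>
  Pairing with \<open>\<Phi> = J\<^sub>p g\<close> gives \<open>\<parallel>g\<parallel>\<^sup>2 \<le> \<parallel>g\<parallel> \<parallel>g - z\<parallel> + \<langle>\<Phi>, z\<rangle>\<close> with \<open>\<langle>\<Phi>, z\<rangle> \<le> \<parallel>g\<parallel> r\<close> on the ball. So no
  point is closer than \<open>\<parallel>g\<parallel> - r\<close>, and a point at this distance is normed by \<open>\<Phi>\<close> and has norm \<open>r\<close>,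
  as has the radial projection of \<open>g\<close>.
\<close>

lemma metric_proj_cball_outside:
  fixes g :: "('s \<Rightarrow> 'x) set"
  assumes g: "g \<in> Lp M p" and r: "0 < r" "r < Lp_norm M p g"
  shows "metric_proj M p (Lp_cball M p r) g = Lp_scale M p (r / Lp_norm M p g) g"
proof -
  have p0: "p > 0" using p by simp
  note C = Lp_cball_eq[OF M p0, of r, where 'a = 'x]
  define N where "N = Lp_norm M p g"
  define h where "h = Lp_scale M p (r / N) g"
  define \<Phi> where "\<Phi> = Jp M p q g"
  note \<Phi> = Jp_props[OF g, folded \<Phi>_def N_def]
  have N: "N > 0" "r < N" using r by (simp_all add: N_def)
  have h: "h \<in> Lp M p" "Lp_norm M p h = r" "pairing M \<Phi> h = N * r"
    using g r N \<Phi> by (auto simp: h_def Lp_scale_in_Lp[OF M p0] Lp_norm_scale[OF M p0] pairing_scale[OF \<Phi>(1)]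
        power2_eq_square simp flip: N_def)
  then have hC: "h \<in> Lp_cball M p r" by (simp add: C)
  have dist_h: "Lp_norm M p (Lp_diff M p g h) = N - r"
    using N by (simp add: h_def Lp_norm_diff_scale[OF M p0 g] field_simps flip: N_def)
  have key: "N * N \<le> N * Lp_norm M p (Lp_diff M p g z) + pairing M \<Phi> z" "pairing M \<Phi> z \<le> N * Lp_norm M p z"
    "Lp_norm M p z \<le> r" "z \<in> Lp M p"
    if "z \<in> Lp_cball M p r" for z
  proof -
    show z: "z \<in> Lp M p" "Lp_norm M p z \<le> r" using that by (auto simp: C)
    show "pairing M \<Phi> z \<le> N * Lp_norm M p z" using pairing_le[OF \<Phi>(1) z(1)] \<Phi>(2) by simp
    have "N * N = pairing M \<Phi> (Lp_diff M p g z) + pairing M \<Phi> z"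
      using pairing_diff[OF \<Phi>(1) g z(1)] \<Phi>(3) by (simp add: power2_eq_square)
    then show "N * N \<le> N * Lp_norm M p (Lp_diff M p g z) + pairing M \<Phi> z"
      using pairing_le[OF \<Phi>(1) Lp_diff_in_Lp[OF M p0 g z(1)]] \<Phi>(2) by simp
  qed
  have low: "N - r \<le> Lp_norm M p (Lp_diff M p g z)" if "z \<in> Lp_cball M p r" for z
  proof -
    have "N * N \<le> N * (Lp_norm M p (Lp_diff M p g z) + Lp_norm M p z)"
      using key(1,2)[OF that] by (simp add: distrib_left)
    then show ?thesis using N key(3)[OF that] by simp
  qed
  show ?thesis unfolding metric_proj_def N_def[symmetric] h_def[symmetric]
  proof (rule the_equality)
    fix z assume z: "z \<in> Lp_cball M p r \<and>
      (\<forall>y\<in>Lp_cball M p r. Lp_norm M p (Lp_diff M p g z) \<le> Lp_norm M p (Lp_diff M p g y))"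
    note k = key[OF conjunct1[OF z]]
    have "Lp_norm M p (Lp_diff M p g z) = N - r" using z hC dist_h low by (metis order_antisym)
    then have 1: "N * r \<le> pairing M \<Phi> z" using k(1) by (simp add: right_diff_distrib)
    with k(2) have "N * r \<le> N * Lp_norm M p z" by linarith
    then have 2: "Lp_norm M p z = r" using k(3) N by simp
    show "z = h"
      by (rule pairing_unique[OF \<Phi>(1) k(4) h(1)]) (use 1 2 k(2) h \<Phi>(2) N in auto)
  qed (use hC dist_h low in auto)
qed

end

theorem theorem6p1:
  fixes M :: "'s measure"
    and p q r :: real
    and g :: "('s \<Rightarrow> 'x::banach) set"
    and \<phi> :: "('s \<Rightarrow> ('x \<Rightarrow>\<^sub>L real)) set"
  assumes "complete_measure M"
    and "uniformly_convex TYPE('x)"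
    and "uniformly_smooth TYPE('x)"
    and "1 < p" and "1 < q" and "1 / p + 1 / q = 1"
    and "0 < r"
    and "g \<in> Lp M p"
    and "\<phi> \<in> Lp M q"
  shows
    "(Lp_norm M q \<phi> \<le> r \<longrightarrow>
        gen_proj M p q (Lp_cball M p r) \<phi> = Jq_star M p q \<phi>) \<and>
     (Lp_norm M q \<phi> > r \<longrightarrow>
        gen_proj M p q (Lp_cball M p r) \<phi> = Lp_scale M p (r / Lp_norm M q \<phi>) (Jq_star M p q \<phi>)) \<and>
     (g \<in> Lp_cball M p r \<longrightarrow>
        gen_metric_proj M p q (Lp_cball M p r) g = g) \<and>
     (g \<in> Lp M p - Lp_cball M p r \<longrightarrow>
        gen_metric_proj M p q (Lp_cball M p r) g = Lp_scale M p (r / Lp_norm M p g) g) \<and>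
     (g \<in> Lp_cball M p r \<longrightarrow>
        metric_proj M p (Lp_cball M p r) g = g) \<and>
     (g \<in> Lp M p - Lp_cball M p r \<longrightarrow>
        metric_proj M p (Lp_cball M p r) g = Lp_scale M p (r / Lp_norm M p g) g)"
proof -
  obtain u where u: "norming_map (blinfun_apply :: ('x \<Rightarrow>\<^sub>L real) \<Rightarrow> 'x \<Rightarrow> real) u"
    using uniformly_convex_norming_map[OF assms(2)] by blast
  obtain v where v: "norming_map (\<lambda>(x::'x) (f :: 'x \<Rightarrow>\<^sub>L real). blinfun_apply f x) v"
    using uniformly_smooth_norming_map[OF assms(3)] by blast
  note ctx = assms(1,4,5,6) u v
  have "p > 0" using assms(4) by simp
  have mem: "g \<in> Lp_cball M p r \<longleftrightarrow> Lp_norm M p g \<le> r"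
    using Lp_cball_eq[OF assms(1) \<open>p > 0\<close>, of r] assms(8) by blast
  show ?thesis
    using gen_proj_cball[OF ctx assms(9,7)] gen_metric_proj_cball[OF ctx assms(8,7)]
      metric_proj_cball_inside[OF ctx, of g r] metric_proj_cball_outside[OF ctx assms(8,7)]
    by (auto simp: mem)
qed

end
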